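(* Let $\mathcal{E}$ be an exponential family with Fisher metric $h_F$ and exponential connection $\nabla^{(e)}$. Then the tangent bundle $T\mathcal{E}$ is a Kähler manifold for the structure $(g,J,\omega)$ associated to $(h_F,\nabla^{(e)})$ via Dombrowski's construction.
   Context: **Exponential families.** An exponential family $\mathcal{E}$ on a measured space $(\Omega,dx)$ (with $dx$ the counting measure if $\Omega$ is discrete) is a set of probability density functions of the form $p(x;\theta)=p_\theta(x)=\exp\{C(x)+\sum_{i=1}^n\theta_iF_i(x)-\psi(\theta)\}$, where $C,F_1,\dots,F_n$ are measurable functions on $\Omega$, $\theta=(\theta_1,\dots,\theta_n)$ varies in an open subset $\Theta$ of $\mathbb{R}^n$, and $\psi:\Theta\to\mathbb{R}$. Standing assumptions: $\{1,F_1,\dots,F_n\}$ is linearly independent, so that $p_\theta\mapsto\theta$ is a global chart making $\mathcal{E}$ a manifold; $\psi$ is smooth; the expectation parameters $\eta_i(p_\theta):=\int_\Omega F_i(x)p_\theta(x)dx$ satisfy $\eta_i=\partial\psi/\partial\theta_i$, and $\theta\mapsto(\partial_{\theta_1}\psi,\dots,\partial_{\theta_n}\psi)$ is a diffeomorphism onto its image; the following objects are well defined and smooth. The Fisher metric is $(h_F)_\theta(\partial_i,\partial_j)=E_{p_\theta}(\partial_i\ln p_\theta\cdot\partial_j\ln p_\theta)$, where $E_{p_\theta}$ is the expectation with respect to $p_\theta\,dx$ and $\partial_i=\partial/\partial\theta_i$. The $\alpha$-connection $\nabla^{(\alpha)}$ has Christoffel symbols $\Gamma^{(\alpha)}_{ij,k}=E_{p_\theta}\big[(\partial_i\partial_j\ln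 p_\theta+\frac{1-\alpha}{2}\partial_i\ln p_\theta\cdot\partial_j\ln p_\theta)\,\partial_k\ln p_\theta\big]$; the exponential connection is $\nabla^{(e)}=\nabla^{(1)}$. **Dombrowski's construction.** Let $M$ be a manifold with Riemannian metric $h$ and affine connection $\nabla$. Let $\pi:TM\to M$ be the projection and $K:T(TM)\to TM$ the connector of $\nabla$ (so that $K(\frac{d}{dt}V(t))=\nabla_{\dot c}V$ for a vector field $V(t)$ along a curve $c(t)$). A tangent vector $A\in T_{u_x}TM$ ($u_x\in T_xM$) is identified with the triple $(u_x,v_x,w_x)$, $v_x=\pi_*A$, $w_x=KA$. Define on $TM$ $g_{u_x}((u_x,v_x,w_x),(u_x,\bar v_x,\bar w_x))=h_x(v_x,\bar v_x)+h_x(w_x,\bar w_x)$, $\omega_{u_x}((u_x,v_x,w_x),(u_x,\bar v_x,\bar w_x))=h_x(v_x,\bar w_x)-h_x(w_x,\bar v_x)$, $J_{u_x}(u_x,v_x,w_x)=(u_x,-w_x,v_x)$. An almost Hermitian structure $(g,J,\omega)$ is Kähler when $J$ is integrable and $d\omega=0$. *)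

theory Defs
  imports "HOL-Analysis.Analysis"
begin

section \<open>Smooth maps on open subsets of Euclidean spaces\<close>

text \<open>
  \<open>Ck_on k f U\<close>: \<open>f\<close> is of class $C^k$ on the open set \<open>U\<close>, expressed through iterated
  directional derivatives (in finite dimension this is the usual notion).
\<close>

primrec Ck_on ::
  "nat \<Rightarrow> ('a::euclidean_space \<Rightarrow> 'b::real_normed_vector) \<Rightarrow> 'a set \<Rightarrow> bool" where
  "Ck_on 0 f U \<longleftrightarrow> continuous_on U f"
| "Ck_on (Suc k) f U \<longleftrightarrow>
     (\<forall>x\<in>U. f differentiable (at x)) \<and>
     (\<forall>v. Ck_on k (\<lambda>x. frechet_derivative f (at x) v) U)"

definition smooth_on ::
  "'a::euclidean_space set \<Rightarrow> ('a \<Rightarrow> 'b::real_normed_vector) \<Rightarrow> bool" where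
  "smooth_on U f \<longleftrightarrow> (\<forall>k. Ck_on k f U)"

definition diffeo_onto_image ::
  "'a::euclidean_space set \<Rightarrow> ('a \<Rightarrow> 'b::euclidean_space) \<Rightarrow> bool" where
  "diffeo_onto_image U f \<longleftrightarrow>
     smooth_on U f \<and> inj_on f U \<and> open (f ` U) \<and> smooth_on (f ` U) (inv_into U f)"

definition partial :: "'n::finite \<Rightarrow> (real^'n \<Rightarrow> real) \<Rightarrow> real^'n \<Rightarrow> real" where
  "partial i f \<theta> = frechet_derivative f (at \<theta>) (axis i 1)"


section \<open>Exponential families\<close>

text \<open>
  A function on the measured space $(\Omega, dx)$ is a function that matters only on
  \<open>space M\<close>; restricting the densities to \<open>space M\<close> makes equality of two densities mean
  equality as functions on $\Omega$.
\<close>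

definition exp_density ::
  "'x measure \<Rightarrow> ('x \<Rightarrow> real) \<Rightarrow> ('n::finite \<Rightarrow> 'x \<Rightarrow> real) \<Rightarrow> (real^'n \<Rightarrow> real) \<Rightarrow>
   real^'n \<Rightarrow> 'x \<Rightarrow> real" where
  "exp_density M C F \<psi> \<theta> = (\<lambda>x\<in>space M. exp (C x + (\<Sum>i\<in>UNIV. \<theta> $ i * F i x) - \<psi> \<theta>))"

definition exp_family ::
  "'x measure \<Rightarrow> ('x \<Rightarrow> real) \<Rightarrow> ('n::finite \<Rightarrow> 'x \<Rightarrow> real) \<Rightarrow> (real^'n \<Rightarrow> real) \<Rightarrow>
   (real^'n) set \<Rightarrow> ('x \<Rightarrow> real) set" where
  "exp_family M C F \<psi> \<Theta> = exp_density M C F \<psi> ` \<Theta>"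

definition natural_chart ::
  "'x measure \<Rightarrow> ('x \<Rightarrow> real) \<Rightarrow> ('n::finite \<Rightarrow> 'x \<Rightarrow> real) \<Rightarrow> (real^'n \<Rightarrow> real) \<Rightarrow>
   (real^'n) set \<Rightarrow> ('x \<Rightarrow> real) \<Rightarrow> real^'n" where
  "natural_chart M C F \<psi> \<Theta> = inv_into \<Theta> (exp_density M C F \<psi>)"

definition expect :: "'x measure \<Rightarrow> ('x \<Rightarrow> real) \<Rightarrow> ('x \<Rightarrow> real) \<Rightarrow> real" where
  "expect M q f = (LINT x|M. f x * q x)"

text \<open>
  In what follows \<open>P\<close> is a parametrised family of densities, \<open>P \<theta> x\<close> standing for $p(x;\theta)$.
\<close>

definition score :: "(real^'n::finite \<Rightarrow> 'x \<Rightarrow> real) \<Rightarrow> 'n \<Rightarrow> real^'n \<Rightarrow> 'x \<Rightarrow> real" where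
  "score P i \<theta> x = partial i (\<lambda>\<theta>'. ln (P \<theta>' x)) \<theta>"

definition score2 :: "(real^'n::finite \<Rightarrow> 'x \<Rightarrow> real) \<Rightarrow> 'n \<Rightarrow> 'n \<Rightarrow> real^'n \<Rightarrow> 'x \<Rightarrow> real" where
  "score2 P i j \<theta> x = partial i (\<lambda>\<theta>'. score P j \<theta>' x) \<theta>"

definition fisher_coeff ::
  "'x measure \<Rightarrow> (real^'n::finite \<Rightarrow> 'x \<Rightarrow> real) \<Rightarrow> real^'n \<Rightarrow> 'n \<Rightarrow> 'n \<Rightarrow> real" where
  "fisher_coeff M P \<theta> i j = expect M (P \<theta>) (\<lambda>x. score P i \<theta> x * score P j \<theta> x)"

definition alpha_integrand ::
  "(real^'n::finite \<Rightarrow> 'x \<Rightarrow> real) \<Rightarrow> real \<Rightarrow> real^'n \<Rightarrow> 'n \<Rightarrow> 'n \<Rightarrow> 'n \<Rightarrow> 'x \<Rightarrow> real" where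
  "alpha_integrand P \<alpha> \<theta> i j k x =
     (score2 P i j \<theta> x + (1 - \<alpha>) / 2 * (score P i \<theta> x * score P j \<theta> x)) * score P k \<theta> x"

text \<open>The Christoffel symbols of the first kind $\Gamma^{(\alpha)}_{ij,k}$.\<close>

definition alpha_christoffel ::
  "'x measure \<Rightarrow> (real^'n::finite \<Rightarrow> 'x \<Rightarrow> real) \<Rightarrow> real \<Rightarrow>
   real^'n \<Rightarrow> 'n \<Rightarrow> 'n \<Rightarrow> 'n \<Rightarrow> real" where
  "alpha_christoffel M P \<alpha> \<theta> i j k = expect M (P \<theta>) (alpha_integrand P \<alpha> \<theta> i j k)"

text \<open>The Fisher metric on coordinate vectors $u = \sum_i u_i \partial_i$, $v = \sum_j v_j \partial_j$.\<close>

definition fisher_metric ::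
  "'x measure \<Rightarrow> (real^'n::finite \<Rightarrow> 'x \<Rightarrow> real) \<Rightarrow> real^'n \<Rightarrow> real^'n \<Rightarrow> real^'n \<Rightarrow> real" where
  "fisher_metric M P \<theta> u v = (\<Sum>i\<in>UNIV. \<Sum>j\<in>UNIV. u $ i * v $ j * fisher_coeff M P \<theta> i j)"

text \<open>
  An affine connection is given in a chart by the bilinear map
  $(u,v) \mapsto \sum_k (\sum_{i,j} \Gamma_{ij}^k u_i v_j) \partial_k$, where
  $\nabla_{\partial_i} \partial_j = \sum_k \Gamma_{ij}^k \partial_k$. For the $\alpha$-connection
  $\Gamma_{ij,k} = h_F(\nabla_{\partial_i} \partial_j, \partial_k)$, so the symbols
  $\Gamma_{ij}^k$ arise by raising the last index with the inverse of the Fisher matrix.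
\<close>

definition alpha_connection ::
  "'x measure \<Rightarrow> (real^'n::finite \<Rightarrow> 'x \<Rightarrow> real) \<Rightarrow> real \<Rightarrow>
   real^'n \<Rightarrow> real^'n \<Rightarrow> real^'n \<Rightarrow> real^'n" where
  "alpha_connection M P \<alpha> \<theta> u v =
     matrix_inv (\<chi> k l. fisher_coeff M P \<theta> k l) *v
       (\<chi> k. \<Sum>i\<in>UNIV. \<Sum>j\<in>UNIV. u $ i * v $ j * alpha_christoffel M P \<alpha> \<theta> i j k)"

abbreviation exp_connection ::
  "'x measure \<Rightarrow> (real^'n::finite \<Rightarrow> 'x \<Rightarrow> real) \<Rightarrow>
   real^'n \<Rightarrow> real^'n \<Rightarrow> real^'n \<Rightarrow> real^'n" where
  "exp_connection M P \<equiv> alpha_connection M P 1"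

text \<open>
  The definition of an exponential family together with the standing regularity assumptions.
  Linear independence of $1, F_1, \dots, F_n$ is that of functions on $\Omega$ (not of classes
  modulo null sets, which would be the stronger requirement).
\<close>

locale exponential_family =
  fixes M :: "'x measure"
    and C :: "'x \<Rightarrow> real"
    and F :: "'n::finite \<Rightarrow> 'x \<Rightarrow> real"
    and \<psi> :: "real^'n \<Rightarrow> real"
    and \<Theta> :: "(real^'n) set"
  assumes open_Theta: "open \<Theta>"
    and measurable_C: "C \<in> borel_measurable M"
    and measurable_F: "\<And>i. F i \<in> borel_measurable M"
    and density: "\<And>\<theta>. \<theta> \<in> \<Theta> \<Longrightarrow> has_bochner_integral M (exp_density M C F \<psi> \<theta>) 1"
    and lin_indep: "\<And>c a. (\<And>x. x \<in> space M \<Longrightarrow> c + (\<Sum>i\<in>UNIV. a $ i * F i x) = 0)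
                      \<Longrightarrow> c = 0 \<and> a = 0"
    and smooth_psi: "smooth_on \<Theta> \<psi>"
    and integrable_F: "\<And>\<theta> i. \<theta> \<in> \<Theta> \<Longrightarrow> integrable M (\<lambda>x. F i x * exp_density M C F \<psi> \<theta> x)"
    and eta: "\<And>\<theta> i. \<theta> \<in> \<Theta> \<Longrightarrow> expect M (exp_density M C F \<psi> \<theta>) (F i) = partial i \<psi> \<theta>"
    and diffeo: "diffeo_onto_image \<Theta> (\<lambda>\<theta>. \<chi> i. partial i \<psi> \<theta>)"
    and integrable_fisher: "\<And>\<theta> i j. \<theta> \<in> \<Theta> \<Longrightarrow> integrable M (\<lambda>x.
          score (exp_density M C F \<psi>) i \<theta> x * score (exp_density M C F \<psi>) j \<theta> x *
          exp_density M C F \<psi> \<theta> x)"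
    and smooth_fisher: "\<And>i j. smooth_on \<Theta> (\<lambda>\<theta>. fisher_coeff M (exp_density M C F \<psi>) \<theta> i j)"
    and integrable_alpha: "\<And>\<alpha> \<theta> i j k. \<theta> \<in> \<Theta> \<Longrightarrow> integrable M (\<lambda>x.
          alpha_integrand (exp_density M C F \<psi>) \<alpha> \<theta> i j k x * exp_density M C F \<psi> \<theta> x)"
    and smooth_alpha: "\<And>\<alpha> i j k.
          smooth_on \<Theta> (\<lambda>\<theta>. alpha_christoffel M (exp_density M C F \<psi>) \<alpha> \<theta> i j k)"


section \<open>Tangent bundle and Dombrowski's construction\<close>

text \<open>
  A manifold \<open>S\<close> (points of type \<open>'p\<close>) with a global chart \<open>\<phi>\<close> into a Euclidean space \<open>'a\<close>:
  a tangent vector at \<open>p\<close> is given by its components, an element of \<open>'a\<close>, in the coordinate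
  frame of \<open>\<phi>\<close>. Thus a point of the tangent bundle is a pair \<open>(p, u)\<close>, the bundle has the global
  chart \<open>(p, u) \<mapsto> (\<phi> p, u)\<close>, and a tangent vector to the bundle is a pair \<open>(a, b)\<close>. A metric
  and a connection are functions \<open>h\<close>, \<open>\<Gamma>\<close> of a point and two tangent vectors at that point.
\<close>

definition tangent_bundle :: "'p set \<Rightarrow> ('p \<times> 'a) set" where
  "tangent_bundle S = S \<times> UNIV"

definition tangent_chart :: "('p \<Rightarrow> 'a) \<Rightarrow> 'p \<times> 'a \<Rightarrow> 'a \<times> 'a" where
  "tangent_chart \<phi> = (\<lambda>(p, u). (\<phi> p, u))"

text \<open>
  If \<open>(c, V)\<close> is a curve in the bundle, then $\nabla_{\dot c} V = \dot V + \Gamma_c(\dot c, V)$;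
  this is the value of the connector on the velocity $(\dot c, \dot V)$ at $(c, V)$.
\<close>

definition connector ::
  "('p \<Rightarrow> 'a \<Rightarrow> 'a \<Rightarrow> 'a::real_vector) \<Rightarrow> 'p \<times> 'a \<Rightarrow> 'a \<times> 'a \<Rightarrow> 'a" where
  "connector \<Gamma> = (\<lambda>(p, u) (a, b). b + \<Gamma> p a u)"

text \<open>The identification of \<open>A\<close> with $(v, w) = (\pi_* A, K A)$ (the base vector \<open>u\<close> is kept apart).\<close>

definition split_vector ::
  "('p \<Rightarrow> 'a \<Rightarrow> 'a \<Rightarrow> 'a::real_vector) \<Rightarrow> 'p \<times> 'a \<Rightarrow> 'a \<times> 'a \<Rightarrow> 'a \<times> 'a" where
  "split_vector \<Gamma> z A = (fst A, connector \<Gamma> z A)"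

definition dombrowski_g ::
  "('p \<Rightarrow> 'a \<Rightarrow> 'a \<Rightarrow> real) \<Rightarrow> ('p \<Rightarrow> 'a \<Rightarrow> 'a \<Rightarrow> 'a::real_vector) \<Rightarrow>
   'p \<times> 'a \<Rightarrow> 'a \<times> 'a \<Rightarrow> 'a \<times> 'a \<Rightarrow> real" where
  "dombrowski_g h \<Gamma> z A B =
     (let (v, w) = split_vector \<Gamma> z A; (v', w') = split_vector \<Gamma> z B
      in h (fst z) v v' + h (fst z) w w')"

definition dombrowski_omega ::
  "('p \<Rightarrow> 'a \<Rightarrow> 'a \<Rightarrow> real) \<Rightarrow> ('p \<Rightarrow> 'a \<Rightarrow> 'a \<Rightarrow> 'a::real_vector) \<Rightarrow>
   'p \<times> 'a \<Rightarrow> 'a \<times> 'a \<Rightarrow> 'a \<times> 'a \<Rightarrow> real" where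
  "dombrowski_omega h \<Gamma> z A B =
     (let (v, w) = split_vector \<Gamma> z A; (v', w') = split_vector \<Gamma> z B
      in h (fst z) v w' - h (fst z) w v')"

definition dombrowski_J ::
  "('p \<Rightarrow> 'a \<Rightarrow> 'a \<Rightarrow> 'a::real_vector) \<Rightarrow> 'p \<times> 'a \<Rightarrow> 'a \<times> 'a \<Rightarrow> 'a \<times> 'a" where
  "dombrowski_J \<Gamma> z A =
     (let (v, w) = split_vector \<Gamma> z A in inv (split_vector \<Gamma> z) (- w, v))"


section \<open>Kaehler structures\<close>

definition riemannian_metric_on ::
  "'a::euclidean_space set \<Rightarrow> ('a \<Rightarrow> 'a \<Rightarrow> 'a \<Rightarrow> real) \<Rightarrow> bool" where
  "riemannian_metric_on U g \<longleftrightarrow>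
     (\<forall>z\<in>U. bilinear (g z) \<and> (\<forall>A B. g z A B = g z B A) \<and> (\<forall>A. A \<noteq> 0 \<longrightarrow> g z A A > 0)) \<and>
     (\<forall>A B. smooth_on U (\<lambda>z. g z A B))"

definition almost_complex_on :: "'a::euclidean_space set \<Rightarrow> ('a \<Rightarrow> 'a \<Rightarrow> 'a) \<Rightarrow> bool" where
  "almost_complex_on U J \<longleftrightarrow>
     (\<forall>z\<in>U. linear (J z) \<and> (\<forall>A. J z (J z A) = - A)) \<and>
     (\<forall>A. smooth_on U (\<lambda>z. J z A))"

definition two_form_on :: "'a::euclidean_space set \<Rightarrow> ('a \<Rightarrow> 'a \<Rightarrow> 'a \<Rightarrow> real) \<Rightarrow> bool" where
  "two_form_on U \<omega> \<longleftrightarrow>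
     (\<forall>z\<in>U. bilinear (\<omega> z) \<and> (\<forall>A. \<omega> z A A = 0)) \<and>
     (\<forall>A B. smooth_on U (\<lambda>z. \<omega> z A B))"

definition almost_hermitian_on ::
  "'a::euclidean_space set \<Rightarrow> ('a \<Rightarrow> 'a \<Rightarrow> 'a \<Rightarrow> real) \<Rightarrow> ('a \<Rightarrow> 'a \<Rightarrow> 'a) \<Rightarrow>
   ('a \<Rightarrow> 'a \<Rightarrow> 'a \<Rightarrow> real) \<Rightarrow> bool" where
  "almost_hermitian_on U g J \<omega> \<longleftrightarrow>
     riemannian_metric_on U g \<and> almost_complex_on U J \<and> two_form_on U \<omega> \<and>
     (\<forall>z\<in>U. \<forall>A B. g z (J z A) (J z B) = g z A B \<and> \<omega> z A B = g z (J z A) B)"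

text \<open>
  \<open>J\<close> is integrable when it comes from a complex structure: around every point there are
  coordinates with values in $\mathbb{C}^m$ whose differential intertwines \<open>J\<close> with
  multiplication by \<open>\<i>\<close>. The transition maps between such coordinates are holomorphic.
\<close>

definition integrable_J_on ::
  "'m::finite itself \<Rightarrow> 'a::euclidean_space set \<Rightarrow> ('a \<Rightarrow> 'a \<Rightarrow> 'a) \<Rightarrow> bool" where
  "integrable_J_on _ U J \<longleftrightarrow>
     (\<forall>z\<in>U. \<exists>V (\<zeta> :: 'a \<Rightarrow> complex^'m).
        open V \<and> z \<in> V \<and> V \<subseteq> U \<and> diffeo_onto_image V \<zeta> \<and>
        (\<forall>y\<in>V. \<forall>A. frechet_derivative \<zeta> (at y) (J y A) = \<i> *s frechet_derivative \<zeta> (at y) A))"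

text \<open>No bracket terms appear because \<open>X\<close>, \<open>Y\<close>, \<open>Z\<close> are constant vector fields.\<close>

definition ext_deriv2 ::
  "('a::euclidean_space \<Rightarrow> 'a \<Rightarrow> 'a \<Rightarrow> real) \<Rightarrow> 'a \<Rightarrow> 'a \<Rightarrow> 'a \<Rightarrow> 'a \<Rightarrow> real" where
  "ext_deriv2 \<omega> z X Y Z =
     frechet_derivative (\<lambda>y. \<omega> y Y Z) (at z) X
     - frechet_derivative (\<lambda>y. \<omega> y X Z) (at z) Y
     + frechet_derivative (\<lambda>y. \<omega> y X Y) (at z) Z"

definition kaehler_on ::
  "'m::finite itself \<Rightarrow> 'a::euclidean_space set \<Rightarrow> ('a \<Rightarrow> 'a \<Rightarrow> 'a \<Rightarrow> real) \<Rightarrow>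
   ('a \<Rightarrow> 'a \<Rightarrow> 'a) \<Rightarrow> ('a \<Rightarrow> 'a \<Rightarrow> 'a \<Rightarrow> real) \<Rightarrow> bool" where
  "kaehler_on m U g J \<omega> \<longleftrightarrow>
     almost_hermitian_on U g J \<omega> \<and> integrable_J_on m U J \<and>
     (\<forall>z\<in>U. \<forall>X Y Z. ext_deriv2 \<omega> z X Y Z = 0)"

text \<open>
  Kaehler manifolds of complex dimension \<open>CARD('m)\<close> with a global (real) chart \<open>\<phi>\<close>: the tensors
  \<open>g\<close>, \<open>J\<close>, \<open>\<omega>\<close> live on \<open>S\<close> and are transported to the open set \<open>\<phi> ` S\<close>.
\<close>

definition kaehler_manifold ::
  "'m::finite itself \<Rightarrow> 'p set \<Rightarrow> ('p \<Rightarrow> 'a::euclidean_space) \<Rightarrow> ('p \<Rightarrow> 'a \<Rightarrow> 'a \<Rightarrow> real) \<Rightarrow>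
   ('p \<Rightarrow> 'a \<Rightarrow> 'a) \<Rightarrow> ('p \<Rightarrow> 'a \<Rightarrow> 'a \<Rightarrow> real) \<Rightarrow> bool" where
  "kaehler_manifold m S \<phi> g J \<omega> \<longleftrightarrow>
     inj_on \<phi> S \<and> open (\<phi> ` S) \<and>
     kaehler_on m (\<phi> ` S)
       (\<lambda>z. g (inv_into S \<phi> z)) (\<lambda>z. J (inv_into S \<phi> z)) (\<lambda>z. \<omega> (inv_into S \<phi> z))"

end

theory Submission
  imports Defs
begin

text \<open>
  In the natural coordinates \<open>\<theta>\<close> the second derivatives of $\ln p_\theta(x)$ do not depend on \<open>x\<close>,
  while the score has mean zero. Hence the Christoffel symbols of the exponential connection
  vanish (\<open>exp_connection_eq_0\<close>), the connector is the projection to the fibre coordinate, and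
  Dombrowski's structure on $T\mathcal{E} \cong \Theta \times \mathbb{R}^n$ becomes
  $g = h \oplus h$, $J(v,w) = (-w,v)$ and
  $\omega((v,w),(v',w')) = h(v,w') - h(w,v')$, where \<open>h\<close> depends on the base point alone.

  Integrability of \<open>J\<close> is then immediate, because \<open>J\<close> is multiplication by \<open>\<i>\<close> in the global
  coordinates $\theta + \mathrm{i}\,u$. The form \<open>\<omega>\<close> is closed as soon as
  $\partial_a h(b,c)$ is symmetric in \<open>a\<close>, \<open>b\<close>, \<open>c\<close> (\<open>flat_dombrowski_kaehler\<close>).

  For the Fisher metric this symmetry comes from probability. By \<open>DERIV_mean\<close>, the derivative
  of $E_\theta[f]$ in the direction \<open>u\<close> is the covariance of \<open>f\<close> with $\sum_i u_i F_i$. The Fisher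
  metric is the covariance of the statistics, so its derivative is their third cumulant
  (\<open>fisher_metric_derivative_third_cumulant\<close>), which is a symmetric expression. Differentiation
  under the integral sign is justified by dominated convergence: the relevant functions are
  integrable at the two parameters $\theta \pm t_0 u$, and the exponentials at these endpoints
  bound all difference quotients in between (\<open>DERIV_integral_exp\<close>).

  Finally \<open>h\<close> is positive definite because $\theta \mapsto \nabla\psi(\theta)$ is injective
  (\<open>fisher_metric_pos\<close>): along a null direction of \<open>h\<close> the density would stay constant
  outside a null set, and with it $\nabla\psi$.
\<close>

section \<open>Calculus of smooth maps\<close>

text \<open>
  On an open set the derivatives of \<open>f\<close> are determined by the values of \<open>f\<close> on that set. This is
  what allows a tensor given by a complicated global expression to be replaced by its simple
  form on the domain of a chart.
\<close>

lemma Ck_on_cong: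
  assumes "open U" and "\<And>x. x \<in> U \<Longrightarrow> f x = g x"
  shows "Ck_on k f U \<longleftrightarrow> Ck_on k g U"
proof -
  have "Ck_on k g U" if "Ck_on k f U" "\<And>x. x \<in> U \<Longrightarrow> f x = g x" for f g :: "'a \<Rightarrow> 'b"
    using that
  proof (induction k arbitrary: f g)
    case 0
    then show ?case by (simp cong: continuous_on_cong)
  next
    case (Suc k)
    have d: "(g has_derivative frechet_derivative f (at x)) (at x)" if "x \<in> U" for x
      using Suc.prems that \<open>open U\<close>
      by (auto simp: frechet_derivative_works intro: has_derivative_transform_within_open)
    then have "frechet_derivative f (at x) = frechet_derivative g (at x)" if "x \<in> U" for x
      using frechet_derivative_at that by blast
    then have "Ck_on k (\<lambda>x. frechet_derivative g (at x) v) U" for v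
      using Suc.IH[of "\<lambda>x. frechet_derivative f (at x) v"] Suc.prems(1) by simp
    then show ?case using d by (auto simp: differentiable_def)
  qed
  then show ?thesis using assms(2) by metis
qed

lemma Ck_on_const: "Ck_on k (\<lambda>x. c) U"
  by (induction k arbitrary: c) simp_all

lemma Ck_on_linear:
  assumes "linear L"
  shows "Ck_on k L U"
proof (cases k)
  case 0
  then show ?thesis using assms by (simp add: linear_continuous_on linear_conv_bounded_linear)
next
  case (Suc j)
  have "(L has_derivative L) (at x)" for x
    using assms by (simp add: linear_imp_has_derivative)
  moreover from this have "frechet_derivative L (at x) = L" for x
    using frechet_derivative_at by metis
  ultimately show ?thesis by (auto simp: Suc Ck_on_const differentiable_def)
qed

lemma Ck_on_add:
  assumes "open U" and "Ck_on k f U" and "Ck_on k g U"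
  shows "Ck_on k (\<lambda>x. f x + g x) U"
  using assms(2,3)
proof (induction k arbitrary: f g)
  case 0
  then show ?case by (simp add: continuous_on_add)
next
  case (Suc k)
  have d: "((\<lambda>x. f x + g x) has_derivative
      (\<lambda>v. frechet_derivative f (at x) v + frechet_derivative g (at x) v)) (at x)" if "x \<in> U" for x
    using Suc.prems that by (intro has_derivative_add) (auto simp: frechet_derivative_works)
  have "Ck_on k (\<lambda>x. frechet_derivative (\<lambda>x. f x + g x) (at x) v) U" for v
  proof -
    have "Ck_on k (\<lambda>x. frechet_derivative f (at x) v + frechet_derivative g (at x) v) U"
      using Suc.IH Suc.prems by simp
    then show ?thesis
      using Ck_on_cong[OF \<open>open U\<close>] frechet_derivative_at[OF d] by (smt (verit, best))
  qed
  then show ?case using d by (auto simp: differentiable_def)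
qed

lemma Ck_on_bounded_linear_image:
  assumes "open U" and "bounded_linear L" and "Ck_on k f U"
  shows "Ck_on k (\<lambda>x. L (f x)) U"
  using assms(3)
proof (induction k arbitrary: f)
  case 0
  then show ?case using bounded_linear.continuous_on[OF assms(2)] by simp
next
  case (Suc k)
  have d: "((\<lambda>x. L (f x)) has_derivative (\<lambda>v. L (frechet_derivative f (at x) v))) (at x)"
    if "x \<in> U" for x
    using Suc.prems that
    by (intro bounded_linear.has_derivative[OF assms(2)]) (auto simp: frechet_derivative_works)
  have "Ck_on k (\<lambda>x. frechet_derivative (\<lambda>x. L (f x)) (at x) v) U" for v
  proof -
    have "Ck_on k (\<lambda>x. L (frechet_derivative f (at x) v)) U"
      using Suc.IH Suc.prems by simp
    then show ?thesis
      using Ck_on_cong[OF \<open>open U\<close>] frechet_derivative_at[OF d] by (smt (verit, best))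
  qed
  then show ?case using d by (auto simp: differentiable_def)
qed

text \<open>
  The derivative of \<open>f \<circ> L\<close> along \<open>v\<close> is the derivative of \<open>f\<close> along the fixed vector \<open>L v\<close>,
  composed with \<open>L\<close>, so the induction closes for linear \<open>L\<close> without a product rule. Its use is
  the pullback of functions along the bundle projection.
\<close>

lemma Ck_on_compose_linear:
  assumes "open U" and "linear L" and "Ck_on k f U"
  shows "Ck_on k (\<lambda>z. f (L z)) (L -` U)"
  using assms(3)
proof (induction k arbitrary: f)
  case 0
  have "continuous_on (L -` U) L"
    using assms(2) by (simp add: linear_continuous_on linear_conv_bounded_linear)
  with 0 show ?case by (auto intro: continuous_on_compose2)
next
  case (Suc k)
  have op: "open (L -` U)"
    using assms(1,2) by (simp add: open_vimage linear_continuous_on linear_conv_bounded_linear)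
  have d: "((\<lambda>z. f (L z)) has_derivative (\<lambda>v. frechet_derivative f (at (L z)) (L v))) (at z)"
    if "z \<in> L -` U" for z
  proof (rule has_derivative_compose[of L L z UNIV f "frechet_derivative f (at (L z))"])
    show "(L has_derivative L) (at z)" using assms(2) by (rule linear_imp_has_derivative)
    show "(f has_derivative frechet_derivative f (at (L z))) (at (L z))"
      using Suc.prems that by (simp add: frechet_derivative_works)
  qed
  have "Ck_on k (\<lambda>z. frechet_derivative (\<lambda>z. f (L z)) (at z) v) (L -` U)" for v
  proof -
    have "Ck_on k (\<lambda>z. frechet_derivative f (at (L z)) (L v)) (L -` U)"
      using Suc.IH[of "\<lambda>x. frechet_derivative f (at x) (L v)"] Suc.prems by simp
    then show ?thesis
      using Ck_on_cong[OF op] frechet_derivative_at[OF d] by (smt (verit, best))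
  qed
  then show ?case using d by (auto simp: differentiable_def)
qed

lemma smooth_on_cong:
  assumes "open U" and "\<And>x. x \<in> U \<Longrightarrow> f x = g x"
  shows "smooth_on U f \<longleftrightarrow> smooth_on U g"
  unfolding smooth_on_def using Ck_on_cong[OF assms] by simp

lemma smooth_on_const: "smooth_on U (\<lambda>x. c)"
  by (simp add: smooth_on_def Ck_on_const)

lemma smooth_on_linear: "linear L \<Longrightarrow> smooth_on U L"
  by (simp add: smooth_on_def Ck_on_linear)

lemma smooth_on_add:
  "open U \<Longrightarrow> smooth_on U f \<Longrightarrow> smooth_on U g \<Longrightarrow> smooth_on U (\<lambda>x. f x + g x)"
  by (simp add: smooth_on_def Ck_on_add)

lemma smooth_on_cmult:
  fixes f :: "'a::euclidean_space \<Rightarrow> real"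
  shows "open U \<Longrightarrow> smooth_on U f \<Longrightarrow> smooth_on U (\<lambda>x. c * f x)"
  by (simp add: smooth_on_def Ck_on_bounded_linear_image[OF _ bounded_linear_mult_right])

lemma smooth_on_sum:
  assumes "open U" and "\<And>i. i \<in> I \<Longrightarrow> smooth_on U (f i)"
  shows "smooth_on U (\<lambda>x. \<Sum>i\<in>I. f i x)"
  using assms(2)
  by (induction I rule: infinite_finite_induct) (simp_all add: smooth_on_const smooth_on_add assms(1))

lemma smooth_on_compose_linear:
  "open U \<Longrightarrow> linear L \<Longrightarrow> smooth_on U f \<Longrightarrow> smooth_on (L -` U) (\<lambda>z. f (L z))"
  by (simp add: smooth_on_def Ck_on_compose_linear)

lemma smooth_on_imp_has_derivative:
  assumes "smooth_on U f" and "x \<in> U"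
  shows "(f has_derivative frechet_derivative f (at x)) (at x)"
proof -
  have "Ck_on (Suc 0) f U" using assms(1) unfolding smooth_on_def by blast
  then show ?thesis using assms(2) by (simp add: frechet_derivative_works)
qed

lemma smooth_on_directional_derivative:
  assumes "smooth_on U f"
  shows "smooth_on U (\<lambda>x. frechet_derivative f (at x) v)"
  unfolding smooth_on_def
proof
  fix k
  have "Ck_on (Suc k) f U" using assms unfolding smooth_on_def by blast
  then show "Ck_on k (\<lambda>x. frechet_derivative f (at x) v) U" by simp
qed

section \<open>The tangent bundle of a flat manifold with a Codazzi metric\<close>

text \<open>
  Over flat coordinates \<open>\<theta>\<close>, the functions $\theta_i + \mathrm{i}\, u_i$ are holomorphic for
  Dombrowski's almost complex structure.
\<close>

definition complex_coordinates :: "(real^'n) \<times> (real^'n) \<Rightarrow> complex^'n::finite" where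
  "complex_coordinates z = (\<chi> i. Complex (fst z $ i) (snd z $ i))"

lemma diffeo_complex_coordinates:
  assumes "open V"
  shows "diffeo_onto_image V (complex_coordinates :: (real^'n) \<times> (real^'n) \<Rightarrow> complex^'n::finite)"
proof -
  let ?\<zeta> = "complex_coordinates :: (real^'n) \<times> (real^'n) \<Rightarrow> complex^'n"
  define \<xi> :: "complex^'n \<Rightarrow> (real^'n) \<times> (real^'n)" where "\<xi> w = (\<chi> i. Re (w $ i), \<chi> i. Im (w $ i))" for w
  have lin: "linear ?\<zeta>" "linear \<xi>"
    by (auto intro!: linearI simp: complex_coordinates_def \<xi>_def vec_eq_iff complex_eq_iff)
  have inv: "\<xi> (?\<zeta> z) = z" "?\<zeta> (\<xi> w) = w" for z w
    by (auto simp: complex_coordinates_def \<xi>_def vec_eq_iff complex_eq_iff prod_eq_iff)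
  have inj: "inj_on ?\<zeta> V" by (metis inj_onI inv(1))
  have "?\<zeta> ` V = \<xi> -` V" by (auto simp: inv image_iff) (metis inv(2))
  then have op: "open (?\<zeta> ` V)"
    using assms lin(2) by (simp add: open_vimage linear_continuous_on linear_conv_bounded_linear)
  have "smooth_on (?\<zeta> ` V) (inv_into V ?\<zeta>)"
    using smooth_on_cong[OF op, of "inv_into V ?\<zeta>" \<xi>] smooth_on_linear[OF lin(2)] inj inv(1)
    by (metis (no_types, lifting) image_iff inv_into_f_f)
  then show ?thesis
    unfolding diffeo_onto_image_def using smooth_on_linear[OF lin(1)] inj op by blast
qed

lemma flat_J_integrable:
  fixes U :: "((real^'n::finite) \<times> (real^'n)) set"
  assumes "open U"
  shows "integrable_J_on TYPE('n) U (\<lambda>z A. (- snd A, fst A))"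
proof -
  have "linear (complex_coordinates :: (real^'n) \<times> (real^'n) \<Rightarrow> complex^'n)"
    by (auto intro!: linearI simp: complex_coordinates_def vec_eq_iff complex_eq_iff)
  then have "frechet_derivative complex_coordinates (at y) =
      (complex_coordinates :: (real^'n) \<times> (real^'n) \<Rightarrow> complex^'n)" for y
    using frechet_derivative_at linear_imp_has_derivative by metis
  moreover have "complex_coordinates (- snd A, fst A) = \<i> *s complex_coordinates A"
    for A :: "(real^'n) \<times> (real^'n)"
    by (simp add: complex_coordinates_def vec_eq_iff complex_eq_iff)
  ultimately show ?thesis
    unfolding integrable_J_on_def using diffeo_complex_coordinates[OF assms] assms
    by (intro ballI exI[of _ U] exI[of _ complex_coordinates]) simp
qed

lemma integrable_J_on_cong:
  assumes "\<And>z A. z \<in> U \<Longrightarrow> J z A = J' z A"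
  shows "integrable_J_on m U J \<longleftrightarrow> integrable_J_on m U J'"
  unfolding integrable_J_on_def using assms by (smt (verit, best) subsetD)

lemma kaehler_on_cong:
  assumes "open U"
    and g: "\<And>z A B. z \<in> U \<Longrightarrow> g z A B = g' z A B"
    and J: "\<And>z A. z \<in> U \<Longrightarrow> J z A = J' z A"
    and \<omega>: "\<And>z A B. z \<in> U \<Longrightarrow> \<omega> z A B = \<omega>' z A B"
  shows "kaehler_on m U g J \<omega> \<longleftrightarrow> kaehler_on m U g' J' \<omega>'"
proof -
  have eq: "g z = g' z" "J z = J' z" "\<omega> z = \<omega>' z" if "z \<in> U" for z
    using that g J \<omega> by blast+
  have herm: "almost_hermitian_on U g J \<omega> \<longleftrightarrow> almost_hermitian_on U g' J' \<omega>'"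
    unfolding almost_hermitian_on_def riemannian_metric_on_def almost_complex_on_def two_form_on_def
    using smooth_on_cong[OF \<open>open U\<close>, of "\<lambda>z. g z _ _" "\<lambda>z. g' z _ _", OF g]
      smooth_on_cong[OF \<open>open U\<close>, of "\<lambda>z. J z _" "\<lambda>z. J' z _", OF J]
      smooth_on_cong[OF \<open>open U\<close>, of "\<lambda>z. \<omega> z _ _" "\<lambda>z. \<omega>' z _ _", OF \<omega>]
    by (simp add: eq cong: ball_cong)
  have fd: "frechet_derivative (\<lambda>y. \<omega> y A B) (at z) = frechet_derivative (\<lambda>y. \<omega>' y A B) (at z)"
    if "z \<in> U" for z A B
  proof -
    have "(g has_derivative D) (at z)"
      if "(f has_derivative D) (at z)" "\<And>y. y \<in> U \<Longrightarrow> f y = g y" for f g :: "'a \<Rightarrow> real" and D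
      using has_derivative_transform_within_open[OF that(1) \<open>open U\<close> \<open>z \<in> U\<close> that(2)] .
    from this[of "\<lambda>y. \<omega> y A B" _ "\<lambda>y. \<omega>' y A B"] this[of "\<lambda>y. \<omega>' y A B" _ "\<lambda>y. \<omega> y A B"]
    have "((\<lambda>y. \<omega> y A B) has_derivative D) (at z) \<longleftrightarrow> ((\<lambda>y. \<omega>' y A B) has_derivative D) (at z)" for D
      using \<omega> by auto
    then show ?thesis unfolding frechet_derivative_def by simp
  qed
  then have ext: "ext_deriv2 \<omega> z X Y Z = ext_deriv2 \<omega>' z X Y Z" if "z \<in> U" for z X Y Z
    using that by (simp add: ext_deriv2_def)
  show ?thesis
    unfolding kaehler_on_def using herm ext integrable_J_on_cong[of U J J' m, OF J] by auto
qed

text \<open>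
  The Kaehler condition for the tangent bundle when the Christoffel symbols of the connection
  vanish. Write $T(a,b,c) = \partial_a h(b,c)$. Symmetry of \<open>h\<close> makes \<open>T\<close> symmetric in its last
  two arguments, and the Codazzi equation, which for vanishing Christoffel symbols is the
  hypothesis below, makes it symmetric in the first two; hence \<open>T\<close> is totally symmetric. In
  $d\omega(X,Y,Z)$ each of the three ways of choosing a vertical component of one vector and
  horizontal components of the other two contributes two values of \<open>T\<close> at the same three
  vectors with opposite signs, so that everything cancels.
\<close>

lemma flat_dombrowski_kaehler:
  fixes h :: "real^'n::finite \<Rightarrow> real^'n \<Rightarrow> real^'n \<Rightarrow> real"
  assumes op: "open U" and h: "riemannian_metric_on U h"
    and codazzi: "\<And>\<theta> a b c. \<theta> \<in> U \<Longrightarrow>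
      frechet_derivative (\<lambda>y. h y b c) (at \<theta>) a = frechet_derivative (\<lambda>y. h y a c) (at \<theta>) b"
  shows "kaehler_on TYPE('n) (U \<times> UNIV)
           (\<lambda>z A B. h (fst z) (fst A) (fst B) + h (fst z) (snd A) (snd B))
           (\<lambda>z A. (- snd A, fst A))
           (\<lambda>z A B. h (fst z) (fst A) (snd B) - h (fst z) (snd A) (fst B))"
    (is "kaehler_on _ ?TU ?g ?J ?\<omega>")
proof -
  have TU: "?TU = fst -` U" "open ?TU"
    using op by (auto intro: open_Times)
  have bil: "bilinear (h \<theta>)" and sym: "h \<theta> a b = h \<theta> b a" and pos: "a \<noteq> 0 \<Longrightarrow> h \<theta> a a > 0"
    if "\<theta> \<in> U" for \<theta> a b
    using h that by (auto simp: riemannian_metric_on_def)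
  have smooth: "smooth_on U (\<lambda>\<theta>. h \<theta> a b)" for a b
    using h by (simp add: riemannian_metric_on_def)
  have smooth': "smooth_on ?TU (\<lambda>z. h (fst z) a b)" for a b
    unfolding TU(1) by (rule smooth_on_compose_linear[OF op _ smooth]) (simp add: linear_fst)
  note hrules = bilinear_ladd[OF bil] bilinear_radd[OF bil] bilinear_lmul[OF bil] bilinear_rmul[OF bil]
    bilinear_lneg[OF bil] bilinear_rneg[OF bil] bilinear_lzero[OF bil] bilinear_rzero[OF bil]
  have metric: "riemannian_metric_on ?TU ?g"
    unfolding riemannian_metric_on_def
  proof (intro conjI ballI allI impI)
    fix z A B assume z: "z \<in> ?TU"
    show "bilinear (?g z)"
      using z by (auto simp: bilinear_def hrules algebra_simps intro!: linearI)
    show "?g z A B = ?g z B A"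
      using z sym by auto
    assume "A \<noteq> 0"
    then have "fst A \<noteq> 0 \<or> snd A \<noteq> 0" by (auto simp: prod_eq_iff)
    moreover have "h (fst z) a a \<ge> 0" for a
      using pos[of "fst z" a] z hrules by (cases "a = 0") (auto simp: less_imp_le)
    ultimately show "?g z A A > 0"
      using pos[of "fst z"] z by (metis SigmaE add_nonneg_pos add_pos_nonneg fst_conv)
  next
    fix A B
    show "smooth_on ?TU (\<lambda>z. ?g z A B)"
      by (intro smooth_on_add TU smooth')
  qed
  have complex: "almost_complex_on ?TU ?J"
    unfolding almost_complex_on_def by (auto intro!: linearI simp: smooth_on_const prod_eq_iff)
  have form: "two_form_on ?TU ?\<omega>"
    unfolding two_form_on_def
  proof (intro conjI ballI allI)
    fix z A assume z: "z \<in> ?TU"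
    show "bilinear (?\<omega> z)"
      using z by (auto simp: bilinear_def hrules algebra_simps intro!: linearI)
    show "?\<omega> z A A = 0"
      using z sym by auto
  next
    fix A B
    have "smooth_on ?TU (\<lambda>z. h (fst z) (fst A) (snd B) + (- 1) * h (fst z) (snd A) (fst B))"
      by (intro smooth_on_add smooth_on_cmult TU smooth')
    then show "smooth_on ?TU (\<lambda>z. ?\<omega> z A B)" by simp
  qed
  have compat: "?g z (?J z A) (?J z B) = ?g z A B" "?\<omega> z A B = ?g z (?J z A) B" if "z \<in> ?TU" for z A B
    using that by (auto simp: hrules)
  have closed: "ext_deriv2 ?\<omega> z X Y Z = 0" if "z \<in> ?TU" for z X Y Z
  proof -
    define T where "T a b c = frechet_derivative (\<lambda>y. h y b c) (at (fst z)) a" for a b c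
    have z: "fst z \<in> U" using that by auto
    have T12: "T a b c = T b a c" for a b c
      unfolding T_def by (rule codazzi[OF z])
    have hT: "((\<lambda>y. h y b c) has_derivative (\<lambda>a. T a b c)) (at (fst z))" for b c
      using smooth_on_imp_has_derivative[OF smooth z] by (simp add: T_def)
    have "((\<lambda>y. h y c b) has_derivative (\<lambda>a. T a b c)) (at (fst z))" for b c
      by (rule has_derivative_transform_within_open[OF hT op z]) (rule sym)
    then have T23: "T a b c = T a c b" for a b c
      using has_derivative_unique[OF hT] by metis
    have "((\<lambda>y. h (fst y) b c) has_derivative (\<lambda>X. T (fst X) b c)) (at z)" for b c
      using has_derivative_compose[of fst fst z UNIV "\<lambda>y. h y b c" "\<lambda>a. T a b c"] hT
      by (simp add: linear_imp_has_derivative linear_fst)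
    then have "((\<lambda>y. ?\<omega> y A B) has_derivative (\<lambda>X. T (fst X) (fst A) (snd B) - T (fst X) (snd A) (fst B))) (at z)"
      for A B
      by (intro has_derivative_diff)
    from frechet_derivative_at[OF this, symmetric]
    have "frechet_derivative (\<lambda>y. ?\<omega> y A B) (at z) =
        (\<lambda>X. T (fst X) (fst A) (snd B) - T (fst X) (snd A) (fst B))" for A B .
    then have "ext_deriv2 ?\<omega> z X Y Z =
        (T (fst X) (fst Y) (snd Z) - T (fst X) (snd Y) (fst Z))
        - (T (fst Y) (fst X) (snd Z) - T (fst Y) (snd X) (fst Z))
        + (T (fst Z) (fst X) (snd Y) - T (fst Z) (snd X) (fst Y))"
      by (simp add: ext_deriv2_def)
    also have "\<dots> = 0"
      using T12[of "fst X" "fst Y" "snd Z"] T12[of "fst X" "fst Z" "snd Y"] T12[of "fst Y" "fst Z" "snd X"]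
        T23[of "fst X" "snd Y" "fst Z"] T23[of "fst Y" "snd X" "fst Z"] T23[of "fst Z" "snd X" "fst Y"]
      by simp
    finally show ?thesis .
  qed
  show ?thesis
    unfolding kaehler_on_def almost_hermitian_on_def
    using metric complex form compat closed flat_J_integrable[OF TU(2)] by blast
qed

section \<open>Differentiating an exponential integral\<close>

text \<open>
  From above the exponential is bounded by its chord over $[0,y]$, from below by its tangent
  at \<open>0\<close>. The estimate makes $(e^{tg} - 1)/t$ bounded for $0 < |t| \le t_0$ by what the exponential
  does at the two endpoints $\pm t_0$.
\<close>

lemma abs_exp_scaled_minus_one_le:
  fixes y s :: real
  assumes "0 \<le> s" and "s \<le> 1"
  shows "\<bar>exp (s * y) - 1\<bar> \<le> s * (exp y + exp (- y))"
proof -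
  have "exp ((1 - s) * 0 + s * y) \<le> (1 - s) * exp 0 + s * exp y"
    using convex_onD[OF exp_convex, of s 0 y] assms by simp
  then have "exp (s * y) - 1 \<le> s * exp y - s" by simp
  then have up: "exp (s * y) - 1 \<le> s * (exp y + exp (- y))"
    using assms by (simp add: algebra_simps) (smt (verit) exp_ge_zero mult_nonneg_nonneg)
  have "1 - exp (s * y) \<le> s * (- y)"
    using exp_ge_add_one_self[of "s * y"] by linarith
  also have "\<dots> \<le> s * (exp y + exp (- y))"
    using exp_ge_add_one_self[of "- y"] exp_gt_zero[of y] assms
    by (intro mult_left_mono) linarith+
  finally show ?thesis using up by linarith
qed

lemma abs_exp_mult_minus_one_le:
  fixes g t t0 :: real
  assumes "0 < t0" and "\<bar>t\<bar> \<le> t0"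
  shows "\<bar>exp (t * g) - 1\<bar> \<le> \<bar>t\<bar> * ((exp (t0 * g) + exp (- t0 * g)) / t0)"
proof -
  \<comment> \<open>The sign of \<open>t\<close> selects the endpoint towards which the parameter moves.\<close>
  let ?y = "sgn t * t0 * g"
  have "\<bar>exp (\<bar>t\<bar> / t0 * ?y) - 1\<bar> \<le> \<bar>t\<bar> / t0 * (exp ?y + exp (- ?y))"
    using assms by (intro abs_exp_scaled_minus_one_le) auto
  moreover have "\<bar>t\<bar> / t0 * ?y = t * g"
    using assms by (simp add: abs_mult_sgn mult.commute mult.left_commute)
  moreover have "\<bar>t\<bar> / t0 * (exp ?y + exp (- ?y)) = \<bar>t\<bar> * ((exp (t0 * g) + exp (- t0 * g)) / t0)"
    by (cases t "0::real" rule: linorder_cases) (auto simp: add.commute)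
  ultimately show ?thesis by metis
qed

text \<open>
  Dominated convergence for the difference quotients. The dominating function
  $|f|(e^{t_0 G} + e^{-t_0 G})/t_0$ is integrable because the integral exists at both endpoints
  $\pm t_0$. It also dominates $|f G|$, whence the first claim.
\<close>

lemma DERIV_integral_exp:
  fixes f G :: "'x \<Rightarrow> real"
  assumes [measurable]: "f \<in> borel_measurable M" "G \<in> borel_measurable M"
    and t0: "0 < t0"
    and int: "\<And>t. \<bar>t\<bar> \<le> t0 \<Longrightarrow> integrable M (\<lambda>x. f x * exp (t * G x))"
  shows "integrable M (\<lambda>x. f x * G x)"
    and "((\<lambda>t. LINT x|M. f x * exp (t * G x)) has_real_derivative (LINT x|M. f x * G x)) (at 0)"
proof -
  define w where "w x = \<bar>f x * exp (t0 * G x)\<bar> / t0 + \<bar>f x * exp (- t0 * G x)\<bar> / t0" for x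
  have w: "integrable M w"
    unfolding w_def using int[of t0] int[of "- t0"] t0
    by (intro Bochner_Integration.integrable_add integrable_divide integrable_abs) auto
  have w_eq: "w x = \<bar>f x\<bar> * ((exp (t0 * G x) + exp (- t0 * G x)) / t0)" for x
    by (simp add: w_def abs_mult algebra_simps add_divide_distrib)
  have "\<bar>f x * G x\<bar> \<le> w x" for x
  proof -
    have "\<bar>t0 * G x\<bar> \<le> exp (t0 * G x) + exp (- (t0 * G x))"
      using exp_ge_add_one_self[of "t0 * G x"] exp_ge_add_one_self[of "- (t0 * G x)"]
        exp_gt_zero[of "t0 * G x"] exp_gt_zero[of "- (t0 * G x)"] by linarith
    then have "\<bar>G x\<bar> \<le> (exp (t0 * G x) + exp (- t0 * G x)) / t0"
      using t0 by (simp add: field_simps abs_mult)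
    then show ?thesis
      unfolding w_eq abs_mult by (intro mult_left_mono) auto
  qed
  then show fG: "integrable M (\<lambda>x. f x * G x)"
    by (intro Bochner_Integration.integrable_bound[OF w]) (auto intro: order_trans[OF _ abs_ge_self])
  have seq: "(\<lambda>n. (\<integral>x. f x * exp (T n * G x) \<partial>M) / T n - (\<integral>x. f x \<partial>M) / T n)
      \<longlonglongrightarrow> (\<integral>x. f x * G x \<partial>M)"
    if T: "T \<longlonglongrightarrow> 0" and T0: "\<And>n. T n \<noteq> 0" and Tt0: "\<And>n. \<bar>T n\<bar> \<le> t0" for T :: "nat \<Rightarrow> real"
  proof -
    let ?s = "\<lambda>n x. f x * ((exp (T n * G x) - 1) / T n)"
    have "(\<lambda>n. \<integral>x. ?s n x \<partial>M) \<longlonglongrightarrow> (\<integral>x. f x * G x \<partial>M)"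
    proof (rule integral_dominated_convergence[OF _ _ w])
      have "((\<lambda>t. exp (t * G x)) has_real_derivative G x) (at 0)" for x
        by (auto intro!: derivative_eq_intros)
      then have "((\<lambda>t. (exp (t * G x) - 1) / t) \<longlongrightarrow> G x) (at 0)" for x
        by (simp add: has_field_derivative_iff)
      then have "(\<lambda>n. (exp (T n * G x) - 1) / T n) \<longlonglongrightarrow> G x" for x
        using T T0 by (auto simp: tendsto_at_iff_sequentially comp_def)
      then show "AE x in M. (\<lambda>n. ?s n x) \<longlonglongrightarrow> f x * G x"
        by (intro AE_I2 tendsto_mult_left)
      have "\<bar>(exp (T n * G x) - 1) / T n\<bar> \<le> (exp (t0 * G x) + exp (- t0 * G x)) / t0" for n x
        using abs_exp_mult_minus_one_le[OF t0 Tt0, of n "G x"] T0[of n]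
        by (simp add: abs_divide pos_divide_le_eq mult.commute)
      then show "AE x in M. norm (?s n x) \<le> w x" for n
        unfolding w_eq real_norm_def abs_mult by (intro AE_I2 mult_left_mono) auto
    qed measurable
    moreover have "(\<integral>x. ?s n x \<partial>M) = (\<integral>x. f x * exp (T n * G x) \<partial>M) / T n - (\<integral>x. f x \<partial>M) / T n" for n
    proof -
      have "?s n x = f x * exp (T n * G x) / T n - f x / T n" for x
        by (simp add: algebra_simps diff_divide_distrib)
      then show ?thesis
        using int[OF Tt0[of n]] int[of 0] t0 by simp
    qed
    ultimately show ?thesis by simp
  qed
  have "((\<lambda>t. ((\<integral>x. f x * exp (t * G x) \<partial>M) - (\<integral>x. f x \<partial>M)) / t) \<longlongrightarrow> (\<integral>x. f x * G x \<partial>M)) (at 0)"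
    unfolding tendsto_at_iff_sequentially comp_def
  proof (intro allI impI)
    fix X :: "nat \<Rightarrow> real" assume X0: "\<forall>i. X i \<in> UNIV - {0}" and X: "X \<longlonglongrightarrow> 0"
    have "\<forall>\<^sub>F n in sequentially. \<bar>X n\<bar> < t0"
      using tendstoD[OF X t0] by simp
    then obtain N where N: "\<And>n. n \<ge> N \<Longrightarrow> \<bar>X n\<bar> < t0"
      unfolding eventually_sequentially by blast
    have "(\<lambda>n. (\<integral>x. f x * exp (X (n + N) * G x) \<partial>M) / X (n + N) - (\<integral>x. f x \<partial>M) / X (n + N))
        \<longlonglongrightarrow> (\<integral>x. f x * G x \<partial>M)"
    proof (rule seq)
      show "(\<lambda>n. X (n + N)) \<longlonglongrightarrow> 0" using X by (rule LIMSEQ_ignore_initial_segment)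
      show "X (n + N) \<noteq> 0" "\<bar>X (n + N)\<bar> \<le> t0" for n
        using X0 N[of "n + N"] by auto
    qed
    then show "(\<lambda>n. ((\<integral>x. f x * exp (X n * G x) \<partial>M) - (\<integral>x. f x \<partial>M)) / X n) \<longlonglongrightarrow> (\<integral>x. f x * G x \<partial>M)"
      unfolding diff_divide_distrib by (rule LIMSEQ_offset)
  qed
  then show "((\<lambda>t. LINT x|M. f x * exp (t * G x)) has_real_derivative (LINT x|M. f x * G x)) (at 0)"
    by (simp add: has_field_derivative_iff)
qed

section \<open>The Fisher metric of an exponential family\<close>

lemma has_derivative_imp_DERIV_along_line:
  fixes f :: "'a::real_normed_vector \<Rightarrow> real"
  assumes "(f has_derivative D) (at \<theta>)"
  shows "((\<lambda>t. f (\<theta> + t *\<^sub>R u)) has_real_derivative D u) (at 0)"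
proof -
  have "((\<lambda>t::real. \<theta> + t *\<^sub>R u) has_derivative (\<lambda>t. t *\<^sub>R u)) (at 0)"
    by (auto intro!: derivative_eq_intros)
  from has_derivative_compose[OF this, of f D]
  have "((\<lambda>t. f (\<theta> + t *\<^sub>R u)) has_derivative (\<lambda>t. D (t *\<^sub>R u))) (at 0)"
    using assms by simp
  moreover have "(\<lambda>t. D (t *\<^sub>R u)) = (*) (D u)"
    using linear_scale[OF has_derivative_linear[OF assms]] by (simp add: fun_eq_iff mult.commute)
  ultimately show ?thesis by (simp add: has_field_derivative_def)
qed

context exponential_family
begin

abbreviation "p \<equiv> exp_density M C F \<psi>"
abbreviation "mean \<theta> \<equiv> expect M (p \<theta>)"

text \<open>
  Working with the linear combinations $\sum_i a_i F_i$ instead of the single statistics \<open>F i\<close>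
  keeps the computations below free of indices.
\<close>

definition stat :: "real^'n \<Rightarrow> 'x \<Rightarrow> real" where
  "stat a x = (\<Sum>i\<in>UNIV. a $ i * F i x)"

text \<open>
  Integrability is required at every parameter at once: as \<open>\<Theta>\<close> is open, an expectation can then
  be differentiated in any direction.
\<close>

definition admissible :: "('x \<Rightarrow> real) \<Rightarrow> bool" where
  "admissible f \<longleftrightarrow> f \<in> borel_measurable M \<and> (\<forall>\<theta>\<in>\<Theta>. integrable M (\<lambda>x. f x * p \<theta> x))"

lemma stat_axis: "stat (axis i 1) x = F i x"
  by (simp add: stat_def axis_def if_distrib[of "\<lambda>c. c * _"] cong: if_cong)

lemma stat_add_scaleR: "stat (a + t *\<^sub>R b) x = stat a x + t * stat b x"
  by (simp add: stat_def algebra_simps sum.distrib sum_distrib_left)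

lemma measurable_stat [measurable]: "stat a \<in> borel_measurable M"
proof -
  have [measurable]: "F i \<in> borel_measurable M" for i by (rule measurable_F)
  show ?thesis unfolding stat_def[abs_def] by measurable
qed

lemma density_eq: "x \<in> space M \<Longrightarrow> p \<theta> x = exp (C x + stat \<theta> x - \<psi> \<theta>)"
  by (simp add: exp_density_def stat_def)

lemma measurable_density [measurable]: "p \<theta> \<in> borel_measurable M"
proof -
  have [measurable]: "C \<in> borel_measurable M" by (rule measurable_C)
  have "(\<lambda>x. exp (C x + stat \<theta> x - \<psi> \<theta>)) \<in> borel_measurable M" by measurable
  then show ?thesis by (simp add: density_eq cong: measurable_cong)
qed

text \<open>
  A translation of the parameter by $t u$ is an exponential tilting of the density by the
  statistic of \<open>u\<close>. Through this identity expectations along a line in \<open>\<Theta>\<close> become exponential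
  integrals with respect to one fixed density.
\<close>

lemma density_shift:
  assumes "x \<in> space M"
  shows "p (\<theta> + t *\<^sub>R u) x = exp (\<psi> \<theta> - \<psi> (\<theta> + t *\<^sub>R u)) * (p \<theta> x * exp (t * stat u x))"
  using assms by (simp add: density_eq stat_add_scaleR flip: exp_add)

lemma mean_shift:
  "mean (\<theta> + t *\<^sub>R u) f =
     exp (\<psi> \<theta> - \<psi> (\<theta> + t *\<^sub>R u)) * (LINT x|M. (f x * p \<theta> x) * exp (t * stat u x))"
proof -
  have "mean (\<theta> + t *\<^sub>R u) f =
      (LINT x|M. exp (\<psi> \<theta> - \<psi> (\<theta> + t *\<^sub>R u)) * ((f x * p \<theta> x) * exp (t * stat u x)))"
    unfolding expect_def by (rule Bochner_Integration.integral_cong) (simp_all add: density_shift mult_ac)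
  then show ?thesis by simp
qed

lemma integrable_shift:
  assumes "admissible f" and "\<theta> + t *\<^sub>R u \<in> \<Theta>"
  shows "integrable M (\<lambda>x. (f x * p \<theta> x) * exp (t * stat u x))"
proof -
  have "integrable M (\<lambda>x. exp (\<psi> (\<theta> + t *\<^sub>R u) - \<psi> \<theta>) * (f x * p (\<theta> + t *\<^sub>R u) x))"
    using assms by (auto simp: admissible_def)
  also have "?this \<longleftrightarrow> ?thesis"
    by (rule Bochner_Integration.integrable_cong) (auto simp: density_shift mult_ac simp flip: exp_add)
  finally show ?thesis .
qed

lemma segment_in_Theta:
  assumes "\<theta> \<in> \<Theta>"
  obtains t0 :: real where "0 < t0" and "\<And>t. \<bar>t\<bar> \<le> t0 \<Longrightarrow> \<theta> + t *\<^sub>R u \<in> \<Theta>"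
proof -
  have "open ((\<lambda>t::real. \<theta> + t *\<^sub>R u) -` \<Theta>)"
    by (intro open_vimage open_Theta continuous_intros)
  moreover have "0 \<in> (\<lambda>t::real. \<theta> + t *\<^sub>R u) -` \<Theta>"
    using assms by simp
  ultimately obtain e where "0 < e" "cball 0 e \<subseteq> (\<lambda>t::real. \<theta> + t *\<^sub>R u) -` \<Theta>"
    using open_contains_cball by blast
  then show thesis
    using that[of e] by (auto simp: subset_iff dist_real_def)
qed

lemma psi_has_derivative:
  "\<theta> \<in> \<Theta> \<Longrightarrow> (\<psi> has_derivative frechet_derivative \<psi> (at \<theta>)) (at \<theta>)"
  by (rule smooth_on_imp_has_derivative[OF smooth_psi])

lemma mean_stat_eq_sum:
  assumes "\<theta> \<in> \<Theta>"
  shows "mean \<theta> (stat u) = (\<Sum>i\<in>UNIV. u $ i * mean \<theta> (F i))"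
proof -
  have "mean \<theta> (stat u) = (LINT x|M. (\<Sum>i\<in>UNIV. u $ i * (F i x * p \<theta> x)))"
    by (simp add: expect_def stat_def sum_distrib_right mult.assoc)
  also have "\<dots> = (\<Sum>i\<in>UNIV. u $ i * mean \<theta> (F i))"
    by (subst Bochner_Integration.integral_sum) (auto simp: integrable_F assms expect_def)
  finally show ?thesis .
qed

lemma mean_stat:
  assumes "\<theta> \<in> \<Theta>"
  shows "mean \<theta> (stat u) = frechet_derivative \<psi> (at \<theta>) u"
proof -
  have lin: "linear (frechet_derivative \<psi> (at \<theta>))"
    using psi_has_derivative[OF assms] by (rule has_derivative_linear)
  have "mean \<theta> (stat u) = (\<Sum>i\<in>UNIV. u $ i * mean \<theta> (F i))"
    by (rule mean_stat_eq_sum[OF assms])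
  also have "\<dots> = (\<Sum>i\<in>UNIV. frechet_derivative \<psi> (at \<theta>) (u $ i *\<^sub>R axis i 1))"
    by (simp add: eta assms partial_def linear_scale[OF lin])
  also have "\<dots> = frechet_derivative \<psi> (at \<theta>) (\<Sum>i\<in>UNIV. u $ i *\<^sub>R axis i 1)"
    by (simp add: linear_sum[OF lin])
  also have "(\<Sum>i\<in>UNIV. u $ i *\<^sub>R axis i 1) = u"
    using basis_expansion[of u] by (simp add: scalar_mult_eq_scaleR)
  finally show ?thesis .
qed

text \<open>
  The derivative of an expectation along \<open>u\<close> is the covariance with the statistic of \<open>u\<close>. In
  \<open>mean_shift\<close> the exponential integral contributes $E[f\,G]$ with $G = \sum_i u_i F_i$, and the
  normalising factor contributes $-E[f]\,\partial_u\psi = -E[f]\,E[G]$. The integrability of $f\,G$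
  comes out along the way, and being valid at every parameter it yields the existence of all
  moments of the $F_i$.
\<close>

lemma DERIV_mean:
  assumes f: "admissible f" and \<theta>: "\<theta> \<in> \<Theta>"
  shows integrable_mult_stat: "integrable M (\<lambda>x. (f x * stat u x) * p \<theta> x)"
    and "((\<lambda>t. mean (\<theta> + t *\<^sub>R u) f) has_real_derivative
           mean \<theta> (\<lambda>x. f x * stat u x) - mean \<theta> f * mean \<theta> (stat u)) (at 0)"
proof -
  obtain t0 where t0: "0 < t0" "\<And>t. \<bar>t\<bar> \<le> t0 \<Longrightarrow> \<theta> + t *\<^sub>R u \<in> \<Theta>"
    using segment_in_Theta[OF \<theta>] by blast
  have [measurable]: "f \<in> borel_measurable M"
    using f by (simp add: admissible_def)
  have "(\<lambda>x. f x * p \<theta> x) \<in> borel_measurable M" by measurable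
  note D = DERIV_integral_exp[OF this measurable_stat t0(1) integrable_shift[OF f t0(2)]]
  have eq: "f x * p \<theta> x * stat u x = (f x * stat u x) * p \<theta> x" for x
    by simp
  show "integrable M (\<lambda>x. (f x * stat u x) * p \<theta> x)"
    using D(1) unfolding eq .
  have "((\<lambda>t. exp (\<psi> \<theta> - \<psi> (\<theta> + t *\<^sub>R u))) has_real_derivative - mean \<theta> (stat u)) (at 0)"
    unfolding mean_stat[OF \<theta>]
    by (rule derivative_eq_intros has_derivative_imp_DERIV_along_line[OF psi_has_derivative[OF \<theta>]] refl | simp)+
  from DERIV_mult[OF this D(2)] show "((\<lambda>t. mean (\<theta> + t *\<^sub>R u) f) has_real_derivative
           mean \<theta> (\<lambda>x. f x * stat u x) - mean \<theta> f * mean \<theta> (stat u)) (at 0)"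
    unfolding mean_shift eq by (simp add: expect_def mult_ac)
qed

lemma admissible_mult_stat: "admissible f \<Longrightarrow> admissible (\<lambda>x. f x * stat u x)"
  using integrable_mult_stat by (auto simp: admissible_def)

lemma admissible_const: "admissible (\<lambda>x. c)"
  using density by (auto simp: admissible_def has_bochner_integral_iff)

lemma admissible_stat: "admissible (stat u)"
  using admissible_mult_stat[OF admissible_const[of 1]] by simp

lemma mean_const: "\<theta> \<in> \<Theta> \<Longrightarrow> mean \<theta> (\<lambda>x. c) = c"
  using density[of \<theta>] by (simp add: expect_def has_bochner_integral_iff)

lemma admissible_add: "admissible f \<Longrightarrow> admissible g \<Longrightarrow> admissible (\<lambda>x. f x + g x)"
  by (auto simp: admissible_def distrib_right)

lemma admissible_cmult: "admissible f \<Longrightarrow> admissible (\<lambda>x. c * f x)"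
  by (auto simp: admissible_def mult.assoc)

lemma mean_add:
  "admissible f \<Longrightarrow> admissible g \<Longrightarrow> \<theta> \<in> \<Theta> \<Longrightarrow> mean \<theta> (\<lambda>x. f x + g x) = mean \<theta> f + mean \<theta> g"
  by (simp add: admissible_def expect_def distrib_right)

lemma mean_cmult: "mean \<theta> (\<lambda>x. c * f x) = c * mean \<theta> f"
  by (simp add: expect_def mult.assoc)

lemma score_density:
  assumes "\<theta> \<in> \<Theta>" and x: "x \<in> space M"
  shows "score p i \<theta> x = F i x - mean \<theta> (F i)"
proof -
  have "linear (\<lambda>\<theta>'. stat \<theta>' x)"
    by (auto intro!: linearI simp: stat_def algebra_simps sum.distrib sum_distrib_left)
  then have "((\<lambda>\<theta>'. stat \<theta>' x) has_derivative (\<lambda>v. stat v x)) (at \<theta>)"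
    by (rule linear_imp_has_derivative)
  then have "((\<lambda>\<theta>'. C x + stat \<theta>' x - \<psi> \<theta>') has_derivative
      (\<lambda>v. 0 + stat v x - frechet_derivative \<psi> (at \<theta>) v)) (at \<theta>)"
    using psi_has_derivative[OF \<open>\<theta> \<in> \<Theta>\<close>]
    by (intro has_derivative_diff has_derivative_add has_derivative_const)
  from frechet_derivative_at[OF this, symmetric]
  have "score p i \<theta> x = stat (axis i 1) x - frechet_derivative \<psi> (at \<theta>) (axis i 1)"
    by (simp add: score_def partial_def density_eq[OF x])
  then show ?thesis
    using eta[OF assms(1)] by (simp add: stat_axis partial_def)
qed

text \<open>
  The logarithm of the density is affine in \<open>\<theta>\<close> up to $\psi(\theta)$, so its second derivatives
  do not depend on \<open>x\<close>. This is why the exponential connection is flat in these coordinates: the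
  mean of a constant times the score vanishes.
\<close>

lemma score2_density:
  assumes \<theta>: "\<theta> \<in> \<Theta>" and x: "x \<in> space M"
  shows "score2 p i j \<theta> x = - partial i (partial j \<psi>) \<theta>"
proof -
  have "smooth_on \<Theta> (partial j \<psi>)"
    unfolding partial_def[abs_def] by (rule smooth_on_directional_derivative[OF smooth_psi])
  from smooth_on_imp_has_derivative[OF this \<theta>]
  have "((\<lambda>\<theta>'. F j x - partial j \<psi> \<theta>') has_derivative
      (\<lambda>v. 0 - frechet_derivative (partial j \<psi>) (at \<theta>) v)) (at \<theta>)"
    by (intro has_derivative_diff has_derivative_const)
  from has_derivative_transform_within_open[OF this open_Theta \<theta>, of "\<lambda>\<theta>'. score p j \<theta>' x"]
  have "((\<lambda>\<theta>'. score p j \<theta>' x) has_derivative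
      (\<lambda>v. 0 - frechet_derivative (partial j \<psi>) (at \<theta>) v)) (at \<theta>)"
    by (simp add: score_density[OF _ x] eta)
  from frechet_derivative_at[OF this, symmetric] show ?thesis
    by (simp add: score2_def partial_def[of i])
qed

lemma exp_christoffel_eq_0:
  assumes \<theta>: "\<theta> \<in> \<Theta>"
  shows "alpha_christoffel M p 1 \<theta> i j k = 0"
proof -
  have "admissible (F k)"
    using admissible_stat[of "axis k 1"] by (simp add: stat_axis[abs_def])
  have "alpha_christoffel M p 1 \<theta> i j k =
      mean \<theta> (\<lambda>x. - partial i (partial j \<psi>) \<theta> * (F k x + (- mean \<theta> (F k))))"
    unfolding alpha_christoffel_def expect_def
    by (rule Bochner_Integration.integral_cong)
      (simp_all add: alpha_integrand_def score2_density[OF \<theta>] score_density[OF \<theta>] expect_def)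
  also have "\<dots> = - partial i (partial j \<psi>) \<theta> * (mean \<theta> (F k) + (- mean \<theta> (F k)))"
    by (simp only: mean_cmult mean_add[OF \<open>admissible (F k)\<close> admissible_const \<theta>] mean_const[OF \<theta>])
  finally show ?thesis by simp
qed

lemma exp_connection_eq_0: "\<theta> \<in> \<Theta> \<Longrightarrow> exp_connection M p \<theta> u v = 0"
  unfolding alpha_connection_def exp_christoffel_eq_0
  by (simp add: vec_eq_iff matrix_vector_mult_def)

lemma fisher_metric_eq_mean:
  assumes \<theta>: "\<theta> \<in> \<Theta>"
  shows "fisher_metric M p \<theta> u v =
    mean \<theta> (\<lambda>x. (stat u x - mean \<theta> (stat u)) * (stat v x - mean \<theta> (stat v)))"
proof -
  have centred: "(\<Sum>i\<in>UNIV. a $ i * score p i \<theta> x) = stat a x - mean \<theta> (stat a)"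
    if "x \<in> space M" for a x
    using that
    by (simp add: score_density[OF \<theta>] mean_stat_eq_sum[OF \<theta>] stat_def algebra_simps sum_subtractf)
  have "fisher_metric M p \<theta> u v =
      (LINT x|M. (\<Sum>i\<in>UNIV. \<Sum>j\<in>UNIV. u $ i * v $ j * (score p i \<theta> x * score p j \<theta> x * p \<theta> x)))"
    using integrable_fisher[OF \<theta>] by (simp add: fisher_metric_def fisher_coeff_def expect_def)
  also have "\<dots> = mean \<theta> (\<lambda>x. (stat u x - mean \<theta> (stat u)) * (stat v x - mean \<theta> (stat v)))"
    unfolding expect_def[of M "p \<theta>" "\<lambda>x. (stat u x - mean \<theta> (stat u)) * (stat v x - mean \<theta> (stat v))"]
  proof (rule Bochner_Integration.integral_cong[OF refl])
    fix x assume "x \<in> space M"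
    then show "(\<Sum>i\<in>UNIV. \<Sum>j\<in>UNIV. u $ i * v $ j * (score p i \<theta> x * score p j \<theta> x * p \<theta> x)) =
        (stat u x - mean \<theta> (stat u)) * (stat v x - mean \<theta> (stat v)) * p \<theta> x"
      unfolding centred[OF \<open>x \<in> space M\<close>, symmetric] sum_product
      unfolding sum_distrib_right by (simp add: mult_ac)
  qed
  finally show ?thesis .
qed

lemma fisher_metric_eq_covariance:
  assumes \<theta>: "\<theta> \<in> \<Theta>"
  shows "fisher_metric M p \<theta> u v =
    mean \<theta> (\<lambda>x. stat u x * stat v x) - mean \<theta> (stat u) * mean \<theta> (stat v)"
proof -
  define m where "m a = mean \<theta> (stat a)" for a
  have "(stat u x - m u) * (stat v x - m v) = stat u x * stat v x
      + ((- m v) * stat u x + ((- m u) * stat v x + m u * m v))" for x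
    by (simp add: algebra_simps)
  then have "fisher_metric M p \<theta> u v = mean \<theta> (\<lambda>x. stat u x * stat v x
      + ((- m v) * stat u x + ((- m u) * stat v x + m u * m v)))"
    by (simp add: fisher_metric_eq_mean[OF \<theta>] m_def)
  also have "\<dots> = mean \<theta> (\<lambda>x. stat u x * stat v x) + ((- m v) * m u + ((- m u) * m v + m u * m v))"
    unfolding m_def
    by (simp only: mean_add[OF _ _ \<theta>] mean_cmult mean_const[OF \<theta>] admissible_stat admissible_mult_stat
        admissible_add admissible_cmult admissible_const)
  finally show ?thesis by (simp add: m_def mult.commute)
qed

text \<open>
  Definiteness rests on the injectivity of $\theta \mapsto \nabla\psi(\theta)$. If $h(u,u) = 0$, then $\sum_i u_i F_i$ has variance
  zero and is constant almost everywhere; tilting by it changes the density only by a constant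
  factor, which normalisation forces to be \<open>1\<close>. Then the expectation parameters at \<open>\<theta>\<close> and
  $\theta + t u$ coincide.
\<close>

lemma fisher_metric_pos:
  assumes \<theta>: "\<theta> \<in> \<Theta>" and "u \<noteq> 0"
  shows "fisher_metric M p \<theta> u u > 0"
proof (rule ccontr)
  define m where "m = mean \<theta> (stat u)"
  let ?f = "\<lambda>x. (stat u x - m)\<^sup>2 * p \<theta> x"
  have h: "fisher_metric M p \<theta> u u = (LINT x|M. ?f x)"
    by (simp add: fisher_metric_eq_mean[OF \<theta>] m_def power2_eq_square) (simp add: expect_def)
  have int: "integrable M ?f"
  proof -
    have "(stat u x - m)\<^sup>2 = stat u x * stat u x + ((- 2 * m) * stat u x + m\<^sup>2)" for x
      by (simp add: power2_eq_square algebra_simps)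
    moreover have "admissible (\<lambda>x. stat u x * stat u x + ((- 2 * m) * stat u x + m\<^sup>2))"
      by (intro admissible_add admissible_cmult admissible_const admissible_mult_stat admissible_stat)
    ultimately show ?thesis using \<theta> by (simp add: admissible_def)
  qed
  have f0: "AE x in M. 0 \<le> ?f x"
    by (auto simp: density_eq)
  assume "\<not> fisher_metric M p \<theta> u u > 0"
  moreover have "(LINT x|M. ?f x) \<ge> 0"
    using f0 by (rule integral_nonneg_AE)
  ultimately have "(LINT x|M. ?f x) = 0" using h by simp
  then have "AE x in M. ?f x = 0"
    using integral_nonneg_eq_0_iff_AE[OF int f0] by simp
  then have const: "AE x in M. stat u x = m"
    by (rule AE_mp) (auto simp: density_eq)
  obtain t where t: "0 < t" "\<theta> + t *\<^sub>R u \<in> \<Theta>"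
    using segment_in_Theta[OF \<theta>, of u] by (metis abs_of_pos order_refl)
  define c where "c = exp (\<psi> \<theta> - \<psi> (\<theta> + t *\<^sub>R u)) * exp (t * m)"
  have shift: "mean (\<theta> + t *\<^sub>R u) f = c * mean \<theta> f" if [measurable]: "f \<in> borel_measurable M" for f
  proof -
    have "(LINT x|M. (f x * p \<theta> x) * exp (t * stat u x)) = (LINT x|M. (f x * p \<theta> x) * exp (t * m))"
      using const by (intro integral_cong_AE) auto
    then show ?thesis by (simp add: mean_shift c_def) (simp add: expect_def)
  qed
  have "c = 1"
    using shift[of "\<lambda>x. 1"] mean_const[of _ 1] \<theta> t(2) by simp
  then have "partial i \<psi> (\<theta> + t *\<^sub>R u) = partial i \<psi> \<theta>" for i
    using shift[OF measurable_F] eta \<theta> t(2) by (metis mult_1)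
  then have "(\<chi> i. partial i \<psi> (\<theta> + t *\<^sub>R u)) = (\<chi> i. partial i \<psi> \<theta>)" by simp
  moreover have "inj_on (\<lambda>\<theta>. \<chi> i. partial i \<psi> \<theta>) \<Theta>"
    using diffeo by (simp add: diffeo_onto_image_def)
  ultimately have "\<theta> + t *\<^sub>R u = \<theta>"
    using \<theta> t(2) by (meson inj_onD)
  with t(1) \<open>u \<noteq> 0\<close> show False by simp
qed

lemma fisher_metric_riemannian: "riemannian_metric_on \<Theta> (fisher_metric M p)"
  unfolding riemannian_metric_on_def
proof (intro conjI ballI allI impI)
  fix \<theta> u v assume \<theta>: "\<theta> \<in> \<Theta>"
  show "bilinear (fisher_metric M p \<theta>)"
    by (auto simp: bilinear_def fisher_metric_def algebra_simps sum.distrib sum_distrib_left intro!: linearI)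
  show "fisher_metric M p \<theta> u v = fisher_metric M p \<theta> v u"
    by (simp add: fisher_metric_eq_mean[OF \<theta>] mult.commute)
  show "fisher_metric M p \<theta> u u > 0" if "u \<noteq> 0"
    using fisher_metric_pos[OF \<theta> that] .
next
  fix u v
  show "smooth_on \<Theta> (\<lambda>\<theta>. fisher_metric M p \<theta> u v)"
    unfolding fisher_metric_def by (intro smooth_on_sum smooth_on_cmult smooth_fisher open_Theta)
qed

text \<open>
  Differentiating the covariance once more gives the third cumulant of the statistics, which
  visibly is symmetric in its three arguments. This replaces the usual argument that \<open>h\<close> is the
  Hessian of \<open>\<psi>\<close> and that third partial derivatives commute.
\<close>

lemma fisher_metric_derivative_third_cumulant:
  fixes a b c :: "real^'n"
  assumes \<theta>: "\<theta> \<in> \<Theta>"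
  defines "m \<equiv> mean \<theta>"
  shows "frechet_derivative (\<lambda>y. fisher_metric M p y b c) (at \<theta>) a =
    m (\<lambda>x. stat a x * stat b x * stat c x)
    - m (stat a) * m (\<lambda>x. stat b x * stat c x)
    - m (stat b) * m (\<lambda>x. stat a x * stat c x)
    - m (stat c) * m (\<lambda>x. stat a x * stat b x)
    + 2 * m (stat a) * m (stat b) * m (stat c)" (is "_ = ?\<kappa>")
proof -
  have "smooth_on \<Theta> (\<lambda>y. fisher_metric M p y b c)"
    using fisher_metric_riemannian by (simp add: riemannian_metric_on_def)
  note lhs = has_derivative_imp_DERIV_along_line[OF smooth_on_imp_has_derivative[OF this \<theta>], of a]
  note stats = admissible_stat admissible_mult_stat[OF admissible_stat]
  have mean_line: "((\<lambda>t. mean (\<theta> + t *\<^sub>R a) (stat b)) has_real_derivative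
      m (\<lambda>x. stat b x * stat a x) - m (stat b) * m (stat a)) (at 0)" for b
    unfolding m_def by (rule DERIV_mean(2)[OF admissible_stat \<theta>])
  have "((\<lambda>t. mean (\<theta> + t *\<^sub>R a) (\<lambda>x. stat b x * stat c x)
      - mean (\<theta> + t *\<^sub>R a) (stat b) * mean (\<theta> + t *\<^sub>R a) (stat c)) has_real_derivative ?\<kappa>) (at 0)"
    by (rule DERIV_cong[OF DERIV_diff[OF DERIV_mean(2)[OF stats(2) \<theta>] DERIV_mult[OF mean_line mean_line]]])
      (simp add: algebra_simps flip: m_def)
  moreover have "open ((\<lambda>t::real. \<theta> + t *\<^sub>R a) -` \<Theta>)"
    by (intro open_vimage open_Theta continuous_intros)
  ultimately have "((\<lambda>t. fisher_metric M p (\<theta> + t *\<^sub>R a) b c) has_real_derivative ?\<kappa>) (at 0)"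
    by (rule has_field_derivative_transform_within_open)
      (simp_all add: \<theta> fisher_metric_eq_covariance)
  then show ?thesis using DERIV_unique[OF lhs] by simp
qed

lemma fisher_metric_codazzi:
  assumes "\<theta> \<in> \<Theta>"
  shows "frechet_derivative (\<lambda>y. fisher_metric M p y b c) (at \<theta>) a =
    frechet_derivative (\<lambda>y. fisher_metric M p y a c) (at \<theta>) b"
  unfolding fisher_metric_derivative_third_cumulant[OF assms] by (simp add: mult_ac)

lemma inj_on_density: "inj_on p \<Theta>"
proof (rule inj_onI)
  fix \<theta> \<theta>' assume eq: "p \<theta> = p \<theta>'"
  have "(\<psi> \<theta>' - \<psi> \<theta>) + (\<Sum>i\<in>UNIV. (\<theta> - \<theta>') $ i * F i x) = 0" if "x \<in> space M" for x
    using fun_cong[OF eq, of x] that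
    by (simp add: density_eq stat_def sum_subtractf left_diff_distrib)
  from lin_indep[OF this] show "\<theta> = \<theta>'" by simp
qed

end

section \<open>The Kaehler structure on the tangent bundle\<close>

theorem corollary4p4:
  fixes M :: "'x measure"
    and C :: "'x \<Rightarrow> real"
    and F :: "'n::finite \<Rightarrow> 'x \<Rightarrow> real"
    and \<psi> :: "real^'n \<Rightarrow> real"
    and \<Theta> :: "(real^'n) set"
  assumes "exponential_family M C F \<psi> \<Theta>"
  defines "P \<equiv> exp_density M C F \<psi>"
    and "E \<equiv> exp_family M C F \<psi> \<Theta>"
    and "\<theta> \<equiv> natural_chart M C F \<psi> \<Theta>"
  defines "h\<^sub>F \<equiv> (\<lambda>p. fisher_metric M P (\<theta> p))"
    and "\<Gamma>\<^sub>e \<equiv> (\<lambda>p. exp_connection M P (\<theta> p))"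
  shows "kaehler_manifold TYPE('n) (tangent_bundle E) (tangent_chart \<theta>)
           (dombrowski_g h\<^sub>F \<Gamma>\<^sub>e) (dombrowski_J \<Gamma>\<^sub>e) (dombrowski_omega h\<^sub>F \<Gamma>\<^sub>e)"
proof -
  interpret exponential_family M C F \<psi> \<Theta> by fact
  let ?S = "tangent_bundle E :: (('x \<Rightarrow> real) \<times> (real^'n)) set" and ?\<phi> = "tangent_chart \<theta>"
  have chart: "\<theta> (P t) = t" if "t \<in> \<Theta>" for t
    using inv_into_f_f[OF inj_on_density that] by (simp add: \<theta>_def P_def natural_chart_def)
  have E: "E = P ` \<Theta>" by (simp add: E_def P_def exp_family_def)
  have inj: "inj_on ?\<phi> ?S"
    by (auto simp: inj_on_def tangent_bundle_def tangent_chart_def E chart)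
  have image: "?\<phi> ` ?S = \<Theta> \<times> UNIV"
    by (force simp: tangent_bundle_def tangent_chart_def E chart)
  have base: "\<theta> (fst (inv_into ?S ?\<phi> z)) = fst z" if "z \<in> \<Theta> \<times> UNIV" for z
    using f_inv_into_f[of z ?\<phi> ?S] that unfolding image
    by (simp add: tangent_chart_def split_beta prod_eq_iff)
  \<comment> \<open>The Christoffel symbols vanish, so the coordinate components \<open>(a, b)\<close> are already \<open>(v, w)\<close>.\<close>
  have flat: "split_vector \<Gamma>\<^sub>e (inv_into ?S ?\<phi> z) = id" if "z \<in> \<Theta> \<times> UNIV" for z
  proof -
    have "fst z \<in> \<Theta>" using that by auto
    then show ?thesis
      using base[OF that]
      by (simp add: fun_eq_iff split_vector_def connector_def split_beta \<Gamma>\<^sub>e_def P_def exp_connection_eq_0)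
  qed
  have "kaehler_on TYPE('n) (\<Theta> \<times> UNIV)
      (\<lambda>z. dombrowski_g h\<^sub>F \<Gamma>\<^sub>e (inv_into ?S ?\<phi> z)) (\<lambda>z. dombrowski_J \<Gamma>\<^sub>e (inv_into ?S ?\<phi> z))
      (\<lambda>z. dombrowski_omega h\<^sub>F \<Gamma>\<^sub>e (inv_into ?S ?\<phi> z)) \<longleftrightarrow>
    kaehler_on TYPE('n) (\<Theta> \<times> UNIV)
      (\<lambda>z A B. fisher_metric M P (fst z) (fst A) (fst B) + fisher_metric M P (fst z) (snd A) (snd B))
      (\<lambda>z A. (- snd A, fst A))
      (\<lambda>z A B. fisher_metric M P (fst z) (fst A) (snd B) - fisher_metric M P (fst z) (snd A) (fst B))"
    by (rule kaehler_on_cong)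
      (auto simp: open_Times open_Theta dombrowski_g_def dombrowski_J_def dombrowski_omega_def
        flat base h\<^sub>F_def split_beta Let_def)
  also have "\<dots>"
    unfolding P_def
    by (rule flat_dombrowski_kaehler[OF open_Theta fisher_metric_riemannian fisher_metric_codazzi])
  finally show ?thesis
    unfolding kaehler_manifold_def image using inj open_Theta by (simp add: open_Times)
qed

end
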